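(* Let $G$ be a connected graph of order $n_1\ge 2$ and let $H$ be a connected graph of order $n_2\ge 2$. If $D(H)\le 2$, then for every integer $k\ge 1$, $$\dim(G\odot^k H)=n_1(n_2+1)^{k-1}\dim(H).$$
   Context: All graphs are finite and simple. For a connected graph $\Gamma$, $d(u,v)$ is the length of a shortest path between $u$ and $v$, and the diameter is $D(\Gamma)=\max_{u,v}d(u,v)$. For a set $S=\{v_1,\dots,v_m\}$ of vertices of a connected graph $\Gamma$, the metric representation of a vertex $v$ is $r(v|S)=(d(v,v_1),\dots,d(v,v_m))$. $S$ is a resolving set for $\Gamma$ if $r(u|S)\ne r(v|S)$ for every pair of distinct vertices $u,v$ of $\Gamma$. The metric dimension $\dim(\Gamma)$ is the minimum cardinality of a resolving set for $\Gamma$. For graphs $G$ and $H$ with $G$ of order $n_1$, the corona product $G\odot H$ is obtained by taking one copy of $G$ and $n_1$ disjoint copies of $H$ and joining by an edge each vertex of the $i$-th copy of $H$ with the $i$-th vertex of $G$. Set $G\odot^1 H=G\odot H$ and, for $k\ge 2$, $G\odot^k H=(G\odot^{k-1}H)\odot H$. *)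

theory Defs
  imports "Graph_Theory.Graph_Theory"
begin

text \<open>
  Finite simple graphs are the library's \<^locale>\<open>pair_graph\<close>s: finite, loop-free digraphs without
  parallel arcs whose arc relation is symmetric.
\<close>

text \<open>
  For a pair of vertices without a connecting path, \<open>graph_dist\<close> is unspecified; it is used for
  connected graphs only.
\<close>
definition graph_dist :: "'a pair_pre_digraph \<Rightarrow> 'a \<Rightarrow> 'a \<Rightarrow> nat" where
  "graph_dist G u v = (LEAST n. \<exists>p. pre_digraph.apath (with_proj G) u p v \<and> length p = n)"

definition diameter :: "'a pair_pre_digraph \<Rightarrow> nat" where
  "diameter G = Max {graph_dist G u v | u v. u \<in> pverts G \<and> v \<in> pverts G}"

text \<open>
  The vector of distances to the members of \<open>S\<close> is indexed by \<open>S\<close> itself rather than by an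
  enumeration of \<open>S\<close>; equality of representations does not depend on the enumeration.
\<close>
definition metric_representation :: "'a pair_pre_digraph \<Rightarrow> 'a set \<Rightarrow> 'a \<Rightarrow> 'a \<Rightarrow> nat" where
  "metric_representation G S v = (\<lambda>s\<in>S. graph_dist G v s)"

definition resolving_set :: "'a pair_pre_digraph \<Rightarrow> 'a set \<Rightarrow> bool" where
  "resolving_set G S \<longleftrightarrow> S \<subseteq> pverts G \<and>
     (\<forall>u\<in>pverts G. \<forall>v\<in>pverts G. u \<noteq> v \<longrightarrow>
        metric_representation G S u \<noteq> metric_representation G S v)"

definition metric_dimension :: "'a pair_pre_digraph \<Rightarrow> nat" where
  "metric_dimension G = Min {card S | S. resolving_set G S}"

text \<open>
  The vertex \<open>(v, None)\<close> is the vertex \<open>v\<close> of \<open>G\<close>, and \<open>(v, Some x)\<close> is the vertex \<open>x\<close> in the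
  copy of \<open>H\<close> attached to \<open>v\<close>.
\<close>
definition corona :: "'a pair_pre_digraph \<Rightarrow> 'b pair_pre_digraph \<Rightarrow> ('a \<times> 'b option) pair_pre_digraph"
    (infixl \<open>\<odot>\<close> 70) where
  "G \<odot> H = \<lparr>
     pverts = {(v, None) | v. v \<in> pverts G} \<union> {(v, Some x) | v x. v \<in> pverts G \<and> x \<in> pverts H},
     parcs = {((u, None), (v, None)) | u v. (u, v) \<in> parcs G}
       \<union> {((v, Some x), (v, Some y)) | v x y. v \<in> pverts G \<and> (x, y) \<in> parcs H}
       \<union> {((v, None), (v, Some x)) | v x. v \<in> pverts G \<and> x \<in> pverts H}
       \<union> {((v, Some x), (v, None)) | v x. v \<in> pverts G \<and> x \<in> pverts H} \<rparr>"

definition relabel :: "('a \<Rightarrow> 'b) \<Rightarrow> 'a pair_pre_digraph \<Rightarrow> 'b pair_pre_digraph" where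
  "relabel f G = \<lparr> pverts = f ` pverts G, parcs = map_prod f f ` parcs G \<rparr>"

text \<open>
  Each corona changes the vertex type, so the iteration renames vertices injectively into one type:
  \<open>(((v, y\<^sub>1), \<dots>), y\<^sub>k)\<close> becomes \<open>(v, [y\<^sub>k, \<dots>, y\<^sub>1])\<close>. The zeroth iterate is a copy of \<open>G\<close>.
\<close>
primrec iterated_corona ::
    "'a pair_pre_digraph \<Rightarrow> nat \<Rightarrow> 'b pair_pre_digraph \<Rightarrow> ('a \<times> 'b option list) pair_pre_digraph"
    (\<open>_ \<odot>[_] _\<close> [70, 0, 71] 70) where
  "G \<odot>[0] H = relabel (\<lambda>v. (v, [])) G"
| "G \<odot>[Suc k] H = relabel (\<lambda>((v, ys), y). (v, y # ys)) ((G \<odot>[k] H) \<odot> H)"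

lemma digraph_iso_relabel:
  assumes "pair_wf_digraph G" and "inj_on f (pverts G)"
  shows "digraph_iso (with_proj G) (with_proj (relabel f G))"
proof -
  interpret pair_wf_digraph G by (rule assms)
  let ?h = "\<lparr> iso_verts = f, iso_arcs = map_prod f f, iso_head = snd, iso_tail = fst \<rparr>"
  have "inj_on (map_prod f f) (parcs G)"
    using assms(2)
    by (intro inj_on_subset[OF map_prod_inj_on[of f "pverts G" f "pverts G"]])
      (auto dest: in_arcsD1 in_arcsD2)
  then have "digraph_isomorphism ?h"
    using assms(2) wf_digraph by (auto simp: digraph_isomorphism_def)
  moreover have "with_proj (relabel f G) = app_iso ?h (with_proj G)"
    by (simp add: relabel_def app_iso_def with_proj_def)
  ultimately show ?thesis
    unfolding digraph_iso_def by blast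
qed

lemma pair_graph_relabel:
  assumes "pair_graph G" and "inj_on f (pverts G)"
  shows "pair_graph (relabel f G)"
proof -
  interpret pair_graph G by (rule assms)
  have "sym (parcs G)"
    using pair_sym_arcs by (simp add: symmetric_def)
  then have "sym (map_prod f f ` parcs G)"
    by (force simp: sym_def)
  then show ?thesis
    using inj_onD[OF assms(2)] pair_finite_verts pair_finite_arcs pair_no_loops
    by unfold_locales
      (auto simp: relabel_def symmetric_def dest: in_arcsD1 in_arcsD2, metis in_arcsD1 in_arcsD2 fst_conv snd_conv)
qed

lemma pair_graph_corona:
  assumes "pair_graph G" and "pair_graph H"
  shows "pair_graph (G \<odot> H)"
proof -
  interpret G: pair_graph G by (rule assms)
  interpret H: pair_graph H by (rule assms)
  have wf: "pair_wf_digraph (G \<odot> H)"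
    by unfold_locales
      (auto simp: corona_def dest: G.in_arcsD1 G.in_arcsD2 H.in_arcsD1 H.in_arcsD2)
  have "pverts (G \<odot> H) \<subseteq> pverts G \<times> insert None (Some ` pverts H)"
    by (auto simp: corona_def)
  then have fin: "finite (pverts (G \<odot> H))"
    by (rule finite_subset) simp
  have "parcs (G \<odot> H) \<subseteq> pverts (G \<odot> H) \<times> pverts (G \<odot> H)"
    using pair_wf_digraph.in_arcsD1[OF wf] pair_wf_digraph.in_arcsD2[OF wf] by auto
  then have fin_arcs: "finite (parcs (G \<odot> H))"
    by (rule finite_subset) (simp add: fin)
  have "sym (parcs G)" "sym (parcs H)"
    using G.pair_sym_arcs H.pair_sym_arcs by (simp_all add: symmetric_def)
  then have "sym (parcs (G \<odot> H))"
    by (auto simp: corona_def sym_def)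
  moreover have "fst e \<noteq> snd e" if "e \<in> parcs (G \<odot> H)" for e
    using that G.pair_no_loops H.pair_no_loops by (force simp: corona_def)
  ultimately show ?thesis
    using wf fin fin_arcs
    by (simp add: pair_graph_def pair_digraph_def pair_pseudo_graph_def pair_fin_digraph_def
        pair_fin_digraph_axioms_def pair_sym_digraph_def pair_sym_digraph_axioms_def
        pair_loopfree_digraph_def pair_loopfree_digraph_axioms_def symmetric_def)
qed

lemma inj_corona_relabelling: "inj (\<lambda>((v, ys), y). (v, y # ys))"
  by (auto simp: inj_def)

lemma pair_graph_iterated_corona:
  assumes "pair_graph G" and "pair_graph H"
  shows "pair_graph (G \<odot>[k] H)"
proof (induction k)
  case 0
  show ?case
    using assms(1) by (auto intro!: pair_graph_relabel simp: inj_on_def)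
next
  case (Suc k)
  show ?case
    unfolding iterated_corona.simps
    by (intro pair_graph_relabel pair_graph_corona Suc.IH assms(2)
        inj_on_subset[OF inj_corona_relabelling]) simp
qed

lemma relabel_relabel: "relabel f (relabel g G) = relabel (f \<circ> g) G"
  by (simp add: relabel_def image_image map_prod.comp[symmetric] image_comp comp_def
      map_prod_def case_prod_unfold)

lemma pverts_corona:
  "pverts (G \<odot> H) = (\<lambda>v. (v, None)) ` pverts G
    \<union> (\<lambda>(v, x). (v, Some x)) ` (pverts G \<times> pverts H)"
  by (auto simp: corona_def)

lemma parcs_corona:
  "parcs (G \<odot> H) = (\<lambda>(u, v). ((u, None), (v, None))) ` parcs G
    \<union> (\<lambda>(v, x, y). ((v, Some x), (v, Some y))) ` (pverts G \<times> parcs H)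
    \<union> (\<lambda>(v, x). ((v, None), (v, Some x))) ` (pverts G \<times> pverts H)
    \<union> (\<lambda>(v, x). ((v, Some x), (v, None))) ` (pverts G \<times> pverts H)"
  by (auto simp: corona_def image_iff; fastforce)

lemma corona_relabel: "relabel f G \<odot> H = relabel (map_prod f id) (G \<odot> H)"
proof -
  have T: "f ` pverts G \<times> pverts H = map_prod f id ` (pverts G \<times> pverts H)"
    "f ` pverts G \<times> parcs H = map_prod f id ` (pverts G \<times> parcs H)"
    by (simp_all add: map_prod_surj_on)
  show ?thesis
    by (intro pair_pre_digraph.equality)
      (simp_all add: pverts_corona parcs_corona relabel_def image_Un image_image case_prod_unfold T)
qed

lemma digraph_iso_iterated_corona_1:
  assumes "pair_graph G" and "pair_graph H"
  shows "digraph_iso (with_proj (G \<odot> H)) (with_proj (G \<odot>[1] H))"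
proof -
  have wf: "pair_wf_digraph (G \<odot> H)"
    using pair_graph_corona[OF assms]
    by (simp add: pair_graph_def pair_digraph_def pair_fin_digraph_def)
  have "G \<odot>[1] H = relabel (\<lambda>(v, y). (v, [y])) (G \<odot> H)"
    unfolding One_nat_def iterated_corona.simps corona_relabel
    by (simp add: relabel_relabel comp_def case_prod_unfold)
  then show ?thesis
    using digraph_iso_relabel[OF wf, of "\<lambda>(v, y). (v, [y])"] by (simp add: inj_on_def split: prod.splits)
qed

lemma digraph_iso_iterated_corona_Suc:
  assumes "pair_graph G" and "pair_graph H"
  shows "digraph_iso (with_proj ((G \<odot>[k] H) \<odot> H)) (with_proj (G \<odot>[Suc k] H))"
proof -
  have "pair_wf_digraph ((G \<odot>[k] H) \<odot> H)"
    using pair_graph_corona[OF pair_graph_iterated_corona[OF assms] assms(2), of k]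
    by (simp add: pair_graph_def pair_digraph_def pair_fin_digraph_def)
  from digraph_iso_relabel[OF this inj_on_subset[OF inj_corona_relabelling]] show ?thesis
    by simp
qed

end

theory Submission
  imports Defs
begin

text \<open>
  A copy of \<open>H\<close> in the corona is joined to the rest only through its base vertex, so vertices outside
  the copy do not separate two of its vertices; and as \<open>D(H) \<le> 2\<close>, distances inside the copy are
  those of \<open>H\<close>. Hence a resolving set meets every copy in a resolving set of \<open>H\<close>. Conversely, the
  union of the copies of one resolving set of \<open>H\<close> resolves the corona, where \<open>n\<^sub>1 \<ge> 2\<close> is needed to
  separate a base vertex from its own copy of \<open>H\<close>. This is the case \<open>k = 1\<close>, and the general case
  is the case \<open>k = 1\<close> for the connected graph \<open>G \<odot>[k - 1] H\<close>.
\<close>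

section \<open>Distances\<close>

text \<open>Each reduction step cuts a closed subwalk out of the walk, so the length never grows.
  This makes \<open>graph_dist\<close>, which is defined by paths, comparable with arbitrary
  walks.\<close>

lemma (in wf_digraph) length_awalk_to_apath:
  assumes "awalk u p v"
  shows "length (awalk_to_apath p) \<le> length p"
  using assms
proof (induct rule: awalk_to_apath_induct)
  case (path p)
  then have "awalk_to_apath p = p"
    by (auto simp: awalk_to_apath.simps)
  then show ?case by simp
next
  case (decomp p q r s)
  have "length (q @ s) \<le> length p"
    using decomp by (auto elim!: awalk_cyc_decompE)
  then show ?case
    using decomp step_awalk_to_apath[of _ p _ q r s] by simp
qed

text \<open>
  These local conditions characterize the distance to \<open>s\<close>; the last one forces \<open>s\<close> to be reachable
  from every vertex.
\<close>
definition distance_function :: "'a pair_pre_digraph \<Rightarrow> 'a \<Rightarrow> ('a \<Rightarrow> nat) \<Rightarrow> bool" where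
  "distance_function G s f \<longleftrightarrow> f s = 0 \<and> (\<forall>u v. (u, v) \<in> parcs G \<longrightarrow> f u \<le> f v + 1) \<and>
     (\<forall>u\<in>pverts G. u \<noteq> s \<longrightarrow> (\<exists>v. (u, v) \<in> parcs G \<and> f u = f v + 1))"

lemma distance_functionI:
  assumes "f s = 0" and "\<And>u v. (u, v) \<in> parcs G \<Longrightarrow> f u \<le> f v + 1"
    and "\<And>u. u \<in> pverts G \<Longrightarrow> u \<noteq> s \<Longrightarrow> \<exists>v. (u, v) \<in> parcs G \<and> f u = f v + 1"
  shows "distance_function G s f"
  unfolding distance_function_def using assms by blast

section \<open>Distance functions compute distances\<close>

context pair_wf_digraph
begin

lemma graph_dist_le_length:
  assumes "awalk u p v"
  shows "graph_dist G u v \<le> length p"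
proof -
  have "graph_dist G u v \<le> length (awalk_to_apath p)"
    unfolding graph_dist_def using apath_awalk_to_apath[OF assms] by (intro Least_le) blast
  then show ?thesis
    using length_awalk_to_apath[OF assms] by simp
qed

lemma graph_dist_awalk:
  assumes "u \<rightarrow>\<^sup>*\<^bsub>with_proj G\<^esub> v"
  obtains p where "awalk u p v" "length p = graph_dist G u v"
proof -
  obtain q where "apath u q v"
    using assms reachable_apath by blast
  then have "\<exists>n p. apath u p v \<and> length p = n"
    by blast
  then have "\<exists>p. apath u p v \<and> length p = graph_dist G u v"
    unfolding graph_dist_def by (rule LeastI_ex)
  then show ?thesis
    using that awalkI_apath by blast
qed

text \<open>Along an arc \<open>f\<close> drops by at most one, and it has to drop to 0 by the end
  of the walk.\<close>

lemma distance_function_le_length: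
  assumes "distance_function G s f" and "awalk u p s"
  shows "f u \<le> length p"
  using assms(2)
proof (induction p arbitrary: u)
  case Nil
  then show ?case
    using assms(1) by (auto simp: awalk_Nil_iff distance_function_def)
next
  case (Cons e p)
  then have "(u, snd e) \<in> parcs G" "awalk (snd e) p s"
    by (auto simp: awalk_Cons_iff)
  with Cons.IH[of "snd e"] assms(1) show ?case
    by (fastforce simp: distance_function_def)
qed

text \<open>Greedy descent: from every vertex other than \<open>s\<close> some arc lowers
  \<open>f\<close> by exactly one, and this can stop only at \<open>s\<close>.\<close>

lemma distance_function_awalk:
  assumes "distance_function G s f" and "u \<in> pverts G" and "s \<in> pverts G"
  shows "\<exists>p. awalk u p s \<and> length p = f u"
  using assms(2)
proof (induction "f u" arbitrary: u rule: less_induct)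
  case less
  show ?case
  proof (cases "u = s")
    case True
    with assms show ?thesis
      by (auto simp: distance_function_def awalk_Nil_iff intro!: exI[of _ "[]"])
  next
    case False
    with less.prems assms(1) obtain v where v: "(u, v) \<in> parcs G" "f u = f v + 1"
      by (auto simp: distance_function_def)
    then obtain p where "awalk v p s" "length p = f v"
      using less.hyps[of v] in_arcsD2 by auto
    with v show ?thesis
      by (intro exI[of _ "(u, v) # p"]) (auto simp: awalk_Cons_iff)
  qed
qed

text \<open>This is the tool for computing distances in a corona: write down a candidate formula and
  check the local conditions.\<close>

lemma graph_dist_eqI:
  assumes "distance_function G s f" and "u \<in> pverts G" and "s \<in> pverts G"
  shows "graph_dist G u s = f u"
proof -
  obtain p where p: "awalk u p s" "length p = f u"
    using distance_function_awalk[OF assms] by blast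
  have "u \<rightarrow>\<^sup>*\<^bsub>with_proj G\<^esub> s"
    using p(1) by (rule reachable_awalkI)
  then obtain q where q: "awalk u q s" "length q = graph_dist G u s"
    by (rule graph_dist_awalk)
  show ?thesis
    using p(2) q(2) graph_dist_le_length[OF p(1)] distance_function_le_length[OF assms(1) q(1)]
    by linarith
qed

text \<open>The descent walks of the distance functions lead from any vertex to any other, so the
  formulas that compute distances also certify connectedness.\<close>

lemma connected_if_distance_functions:
  assumes "pverts G \<noteq> {}" and "\<And>s. s \<in> pverts G \<Longrightarrow> \<exists>f. distance_function G s f"
  shows "connected (with_proj G)"
  unfolding Digraph_Component.connected_def
proof (rule strongly_connectedI)
  show "verts (with_proj (mk_symmetric (with_proj G))) \<noteq> {}"
    using assms by simp
next
  fix u v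
  assume "u \<in> verts (with_proj (mk_symmetric (with_proj G)))"
    and "v \<in> verts (with_proj (mk_symmetric (with_proj G)))"
  then have "u \<rightarrow>\<^sup>*\<^bsub>with_proj G\<^esub> v"
    using assms(2)[of v] distance_function_awalk[of v _ u] unfolding reachable_awalk by auto
  then show "u \<rightarrow>\<^sup>*\<^bsub>with_proj (mk_symmetric (with_proj G))\<^esub> v"
    by (rule reachable_mk_symmetricI)
qed

end

text \<open>Converse of \<open>graph_dist_eqI\<close>: it provides the distance functions of
  \<open>G\<close> and \<open>H\<close> from which those of the corona are assembled. Symmetry of
  the arcs turns connectedness into reachability of \<open>s\<close> from every vertex.\<close>

lemma (in pair_sym_digraph) distance_function_graph_dist:
  assumes "connected (with_proj G)" and s: "s \<in> pverts G"
  shows "distance_function G s (\<lambda>u. graph_dist G u s)"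
proof -
  have reach: "u \<rightarrow>\<^sup>*\<^bsub>with_proj G\<^esub> s" if "u \<in> pverts G" for u
    using symmetric_connected_imp_strongly_connected[OF sym_arcs assms(1)] that s by auto
  have step: "graph_dist G u s \<le> graph_dist G v s + 1" if uv: "(u, v) \<in> parcs G" for u v
  proof -
    obtain p where "awalk v p s" "length p = graph_dist G v s"
      using graph_dist_awalk[OF reach[OF in_arcsD2[OF uv]]] .
    then show ?thesis
      using graph_dist_le_length[of u "(u, v) # p" s] uv by (auto simp: awalk_Cons_iff in_arcsD1)
  qed
  have "\<exists>v. (u, v) \<in> parcs G \<and> graph_dist G u s = graph_dist G v s + 1"
    if u: "u \<in> pverts G" "u \<noteq> s" for u
  proof -
    obtain p where p: "awalk u p s" "length p = graph_dist G u s"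
      using graph_dist_awalk[OF reach] u by blast
    then obtain e q where eq: "p = e # q"
      using u by (cases p) (auto simp: awalk_Nil_iff)
    then have e: "(u, snd e) \<in> parcs G" and "awalk (snd e) q s"
      using p by (auto simp: awalk_Cons_iff)
    \<comment> \<open>The rest of a shortest walk bounds the distance of its second vertex from
      above; \<open>step\<close> gives the matching lower bound.\<close>
    then have "graph_dist G (snd e) s \<le> length q"
      using graph_dist_le_length by blast
    then show ?thesis
      using e step[OF e] p eq by fastforce
  qed
  moreover have "graph_dist G s s = 0"
    using graph_dist_le_length[of s "[]" s] s by (simp add: awalk_Nil_iff)
  ultimately show ?thesis
    using step by (auto simp: distance_function_def)
qed

lemma (in pair_sym_digraph) graph_dist_eq_0_iff:
  assumes "connected (with_proj G)" and "u \<in> pverts G" and "v \<in> pverts G"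
  shows "graph_dist G u v = 0 \<longleftrightarrow> u = v"
  using distance_function_graph_dist[OF assms(1,3)] assms(2)
  by (auto simp: distance_function_def)

section \<open>Resolving sets\<close>

lemma resolving_set_iff:
  "resolving_set G S \<longleftrightarrow> S \<subseteq> pverts G \<and>
    (\<forall>u\<in>pverts G. \<forall>v\<in>pverts G. u \<noteq> v \<longrightarrow> (\<exists>s\<in>S. graph_dist G u s \<noteq> graph_dist G v s))"
  unfolding resolving_set_def metric_representation_def
  by (metis (mono_tags, lifting) restrict_apply' restrict_ext)

text \<open>Of two distinct vertices, only the first has distance 0 to the first. Thus resolving
  sets exist and the minimum in \<open>metric_dimension\<close> is taken over a nonempty
  set.\<close>

lemma resolving_set_pverts:
  assumes "pair_sym_digraph G" and "Digraph_Component.connected (with_proj G)"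
  shows "resolving_set G (pverts G)"
  unfolding resolving_set_iff using pair_sym_digraph.graph_dist_eq_0_iff[OF assms] by (metis order_refl)

lemma finite_resolving_sets:
  assumes "finite (pverts G)"
  shows "finite {card S | S. resolving_set G S}"
proof -
  have "{S. resolving_set G S} \<subseteq> Pow (pverts G)"
    by (auto simp: resolving_set_def)
  then have "finite {S. resolving_set G S}"
    using assms finite_subset by blast
  then show ?thesis by simp
qed

lemma metric_dimension_le:
  assumes "finite (pverts G)" and "resolving_set G S"
  shows "metric_dimension G \<le> card S"
  unfolding metric_dimension_def using assms(2) by (intro Min_le finite_resolving_sets assms(1)) blast

lemma metric_dimension_attained:
  assumes "pair_graph G" and "Digraph_Component.connected (with_proj G)"
  obtains S where "resolving_set G S" "card S = metric_dimension G"
proof -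
  interpret pair_graph G by (rule assms(1))
  have "resolving_set G (pverts G)"
    by (rule resolving_set_pverts[OF pair_sym_digraph_axioms assms(2)])
  then have "{card S | S. resolving_set G S} \<noteq> {}" by blast
  then have "metric_dimension G \<in> {card S | S. resolving_set G S}"
    unfolding metric_dimension_def by (intro Min_in finite_resolving_sets pair_finite_verts)
  then show ?thesis using that by force
qed

section \<open>Relabelling\<close>

text \<open>The arcs of the relabelled graph are the images of arcs of \<open>G\<close>, so the
  local conditions carry over once vertices are pulled back along the inverse of
  \<open>f\<close>.\<close>

lemma distance_function_relabel:
  assumes "inj_on f (pverts G)" and "pair_wf_digraph G" and "s \<in> pverts G"
    and "distance_function G s g"
  shows "distance_function (relabel f G) (f s) (g \<circ> the_inv_into (pverts G) f)"
proof -
  interpret pair_wf_digraph G by (rule assms(2))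
  have [simp]: "the_inv_into (pverts G) f (f u) = u" if "u \<in> pverts G" for u
    using that assms(1) by (rule the_inv_into_f_f[rotated])
  have "\<exists>y. (f u, y) \<in> map_prod f f ` parcs G \<and> g u = g (the_inv_into (pverts G) f y) + 1"
    if u: "u \<in> pverts G" "f u \<noteq> f s" for u
  proof -
    obtain v where "(u, v) \<in> parcs G" "g u = g v + 1"
      using assms(4) u by (auto simp: distance_function_def)
    then show ?thesis
      by (intro exI[of _ "f v"]) (auto dest: in_arcsD2)
  qed
  moreover have "g (the_inv_into (pverts G) f (f u)) \<le> g (the_inv_into (pverts G) f (f v)) + 1"
    if "(u, v) \<in> parcs G" for u v
    using that assms(4) in_arcsD1[OF that] in_arcsD2[OF that] by (simp add: distance_function_def)
  ultimately show ?thesis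
    using assms(3,4) by (auto simp: distance_function_def relabel_def)
qed

lemma
  assumes "inj_on f (pverts G)" and "pair_graph G"
    and "Digraph_Component.connected (with_proj G)"
  shows connected_relabel: "Digraph_Component.connected (with_proj (relabel f G))"
    and graph_dist_relabel: "u \<in> pverts G \<Longrightarrow> v \<in> pverts G \<Longrightarrow>
      graph_dist (relabel f G) (f u) (f v) = graph_dist G u v"
proof -
  interpret pair_graph G by (rule assms(2))
  interpret R: pair_graph "relabel f G" by (rule pair_graph_relabel[OF assms(2,1)])
  have df: "distance_function (relabel f G) (f s)
      ((\<lambda>u. graph_dist G u s) \<circ> the_inv_into (pverts G) f)" if "s \<in> pverts G" for s
    using that distance_function_graph_dist[OF assms(3)]
    by (intro distance_function_relabel assms(1) pair_wf_digraph_axioms)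
  have ne: "pverts G \<noteq> {}"
    using assms(3) by (auto simp: connected_def strongly_connected_def)
  show "Digraph_Component.connected (with_proj (relabel f G))"
  proof (rule R.connected_if_distance_functions)
    show "pverts (relabel f G) \<noteq> {}"
      using ne by (simp add: relabel_def)
    show "\<exists>g. distance_function (relabel f G) t g" if t: "t \<in> pverts (relabel f G)" for t
    proof -
      obtain s where "t = f s" "s \<in> pverts G"
        using t by (auto simp: relabel_def)
      then show ?thesis
        using df by blast
    qed
  qed
  show "graph_dist (relabel f G) (f u) (f v) = graph_dist G u v"
    if "u \<in> pverts G" "v \<in> pverts G"
  proof -
    have "f u \<in> pverts (relabel f G)" "f v \<in> pverts (relabel f G)"
      using that by (simp_all add: relabel_def)
    then show ?thesis
      by (subst R.graph_dist_eqI[OF df[OF that(2)]]) (simp_all add: the_inv_into_f_f assms(1) that(1))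
  qed
qed

text \<open>Taking images under \<open>f\<close> is a cardinality-preserving bijection between the
  resolving sets of the two graphs.\<close>

lemma metric_dimension_relabel:
  assumes "inj_on f (pverts G)" and "pair_graph G"
    and "Digraph_Component.connected (with_proj G)"
  shows "metric_dimension (relabel f G) = metric_dimension G"
proof -
  have verts: "pverts (relabel f G) = f ` pverts G"
    by (simp add: relabel_def)
  have res: "resolving_set (relabel f G) (f ` S) \<longleftrightarrow> resolving_set G S" if "S \<subseteq> pverts G" for S
  proof -
    have dist: "graph_dist (relabel f G) (f u) (f s) = graph_dist G u s"
      if "u \<in> pverts G" "s \<in> S" for u s
      using that \<open>S \<subseteq> pverts G\<close> by (intro graph_dist_relabel assms) auto
    have eq: "f u = f v \<longleftrightarrow> u = v" if "u \<in> pverts G" "v \<in> pverts G" for u v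
      using that by (rule inj_on_eq_iff[OF assms(1)])
    have "f ` S \<subseteq> f ` pverts G"
      using that by (rule image_mono)
    then show ?thesis
      using that unfolding resolving_set_iff verts ball_simps bex_simps
      by (simp add: dist eq cong: ball_cong bex_cong)
  qed
  have "{card S | S. resolving_set (relabel f G) S} = {card S | S. resolving_set G S}"
  proof (intro equalityI subsetI; clarify)
    fix S assume S: "resolving_set (relabel f G) S"
    then have "S \<subseteq> f ` pverts G"
      by (simp add: resolving_set_iff verts)
    then obtain T where T: "T \<subseteq> pverts G" "S = f ` T"
      by (auto simp: subset_image_iff)
    moreover have "card S = card T"
      using card_image[OF inj_on_subset[OF assms(1) T(1)]] T(2) by simp
    ultimately show "\<exists>T. card S = card T \<and> resolving_set G T"
      using S res by auto
  next
    fix S assume S: "resolving_set G S"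
    then have "S \<subseteq> pverts G"
      by (simp add: resolving_set_iff)
    moreover from this have "card (f ` S) = card S"
      by (rule card_image[OF inj_on_subset[OF assms(1)]])
    ultimately show "\<exists>T. card S = card T \<and> resolving_set (relabel f G) T"
      using S res by metis
  qed
  then show ?thesis
    by (simp add: metric_dimension_def)
qed

section \<open>The corona product\<close>

lemma corona_arcE:
  assumes "(p, q) \<in> parcs (G \<odot> H)"
  obtains u v where "p = (u, None)" "q = (v, None)" "(u, v) \<in> parcs G"
    | v x y where "p = (v, Some x)" "q = (v, Some y)" "v \<in> pverts G" "(x, y) \<in> parcs H"
    | v x where "p = (v, None)" "q = (v, Some x)" "v \<in> pverts G" "x \<in> pverts H"
    | v x where "p = (v, Some x)" "q = (v, None)" "v \<in> pverts G" "x \<in> pverts H"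
  using assms unfolding corona_def pair_pre_digraph.simps Un_iff mem_Collect_eq prod.inject by blast

lemma corona_vertE:
  assumes "p \<in> pverts (G \<odot> H)"
  obtains v where "p = (v, None)" "v \<in> pverts G"
    | v x where "p = (v, Some x)" "v \<in> pverts G" "x \<in> pverts H"
  using assms unfolding corona_def pair_pre_digraph.simps Un_iff mem_Collect_eq by blast

lemma mem_pverts_corona [simp]:
  "(v, y) \<in> pverts (G \<odot> H) \<longleftrightarrow> v \<in> pverts G \<and> set_option y \<subseteq> pverts H"
  by (cases y) (simp_all add: corona_def)

lemma mem_parcs_corona [simp]:
  "((u, None), (v, None)) \<in> parcs (G \<odot> H) \<longleftrightarrow> (u, v) \<in> parcs G"
  "((u, Some x), (v, Some y)) \<in> parcs (G \<odot> H) \<longleftrightarrow> u = v \<and> v \<in> pverts G \<and> (x, y) \<in> parcs H"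
  "((u, None), (v, Some x)) \<in> parcs (G \<odot> H) \<longleftrightarrow> u = v \<and> v \<in> pverts G \<and> x \<in> pverts H"
  "((u, Some x), (v, None)) \<in> parcs (G \<odot> H) \<longleftrightarrow> u = v \<and> v \<in> pverts G \<and> x \<in> pverts H"
  by (simp_all add: corona_def; blast)+

text \<open>A copy vertex can leave its copy only through its base vertex, which costs one extra
  step.\<close>

lemma distance_function_corona_base:
  assumes "distance_function G s f"
  shows "distance_function (G \<odot> H) (s, None) (\<lambda>(v, y). f v + (if y = None then 0 else 1))"
    (is "distance_function _ _ ?d")
proof -
  have fs: "f s = 0" and f1: "\<And>u v. (u, v) \<in> parcs G \<Longrightarrow> f u \<le> f v + 1"
    and f2: "\<And>u. u \<in> pverts G \<Longrightarrow> u \<noteq> s \<Longrightarrow> \<exists>v. (u, v) \<in> parcs G \<and> f u = f v + 1"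
    using assms unfolding distance_function_def by blast+
  show ?thesis
  proof (rule distance_functionI)
    show "?d (s, None) = 0"
      using fs by simp
    show "?d p \<le> ?d q + 1" if "(p, q) \<in> parcs (G \<odot> H)" for p q
      using that
    proof (cases rule: corona_arcE)
      case (1 u v)
      then show ?thesis using f1[of u v] by simp
    qed simp_all
    show "\<exists>q. (p, q) \<in> parcs (G \<odot> H) \<and> ?d p = ?d q + 1"
      if p: "p \<in> pverts (G \<odot> H)" "p \<noteq> (s, None)" for p
      using p(1)
    proof (cases rule: corona_vertE)
      case (1 v)
      then obtain w where "(v, w) \<in> parcs G" "f v = f w + 1"
        using f2 p(2) by blast
      then show ?thesis
        using 1 by (intro exI[of _ "(w, None)"]) simp
    next
      case (2 v x)
      then show ?thesis
        by (intro exI[of _ "(v, None)"]) simp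
    qed
  qed
qed

text \<open>From another copy a shortest path steps to its base vertex, crosses \<open>G\<close> to
  \<open>s\<close> and enters the copy at \<open>s\<close>, hence the summand 2. Inside the copy at
  \<open>s\<close> the only shortcut is the detour through \<open>s\<close> of length 2, which never
  beats \<open>g\<close> because \<open>g\<close> is at most 2.\<close>

lemma distance_function_corona_copy:
  assumes "distance_function G s f" and "s \<in> pverts G"
    and "distance_function H b g" and "b \<in> pverts H"
    and le2: "\<And>x. x \<in> pverts H \<Longrightarrow> g x \<le> 2"
  shows "distance_function (G \<odot> H) (s, Some b)
    (\<lambda>(v, y). case y of None \<Rightarrow> f v + 1 | Some x \<Rightarrow> if v = s then g x else f v + 2)"
    (is "distance_function _ _ ?d")
proof -
  have fs: "f s = 0" and f1: "\<And>u v. (u, v) \<in> parcs G \<Longrightarrow> f u \<le> f v + 1"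
    and f2: "\<And>u. u \<in> pverts G \<Longrightarrow> u \<noteq> s \<Longrightarrow> \<exists>v. (u, v) \<in> parcs G \<and> f u = f v + 1"
    using assms(1) unfolding distance_function_def by blast+
  have gb: "g b = 0" and g1: "\<And>u v. (u, v) \<in> parcs H \<Longrightarrow> g u \<le> g v + 1"
    and g2: "\<And>u. u \<in> pverts H \<Longrightarrow> u \<noteq> b \<Longrightarrow> \<exists>v. (u, v) \<in> parcs H \<and> g u = g v + 1"
    using assms(3) unfolding distance_function_def by blast+
  show ?thesis
  proof (rule distance_functionI)
    show "?d (s, Some b) = 0"
      using gb by simp
    show "?d p \<le> ?d q + 1" if "(p, q) \<in> parcs (G \<odot> H)" for p q
      using that
    proof (cases rule: corona_arcE)
      case (1 u v)
      then show ?thesis using f1[of u v] by simp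
    next
      case (2 v x y)
      then show ?thesis using g1[of x y] by simp
    next
      case (3 v x)
      then show ?thesis using fs by simp
    next
      case (4 v x)
      \<comment> \<open>The base vertex \<open>s\<close> has value 1, so its neighbours in the copy
        may have value at most 2; this is where the bound on \<open>g\<close> enters.\<close>
      then show ?thesis using fs le2[of x] by simp
    qed
    show "\<exists>q. (p, q) \<in> parcs (G \<odot> H) \<and> ?d p = ?d q + 1"
      if p: "p \<in> pverts (G \<odot> H)" "p \<noteq> (s, Some b)" for p
      using p(1)
    proof (cases rule: corona_vertE)
      case (1 v)
      show ?thesis
      proof (cases "v = s")
        case True
        then show ?thesis
          \<comment> \<open>The base vertex is adjacent to all of its copy, in particular to the
            target itself.\<close>
          using 1 assms(2,4) fs gb by (intro exI[of _ "(s, Some b)"]) simp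
      next
        case False
        then obtain w where "(v, w) \<in> parcs G" "f v = f w + 1"
          using f2 1 by blast
        then show ?thesis
          using 1 by (intro exI[of _ "(w, None)"]) simp
      qed
    next
      case (2 v x)
      show ?thesis
      proof (cases "v = s")
        case True
        then obtain z where "(x, z) \<in> parcs H" "g x = g z + 1"
          using g2 2 p(2) by blast
        then show ?thesis
          using 2 True assms(2) by (intro exI[of _ "(s, Some z)"]) simp
      next
        case False
        then show ?thesis
          using 2 by (intro exI[of _ "(v, None)"]) simp
      qed
    qed
  qed
qed

lemma graph_dist_le_diameter:
  assumes "finite (pverts G)" and "u \<in> pverts G" and "v \<in> pverts G"
  shows "graph_dist G u v \<le> diameter G"
proof -
  have "{graph_dist G u v | u v. u \<in> pverts G \<and> v \<in> pverts G}
      = case_prod (graph_dist G) ` (pverts G \<times> pverts G)"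
    by auto
  then have "finite {graph_dist G u v | u v. u \<in> pverts G \<and> v \<in> pverts G}"
    using assms(1) by simp
  then show ?thesis
    unfolding diameter_def using assms(2,3) by (intro Max_ge) auto
qed

lemma card_pverts_corona:
  assumes "finite (pverts G)" and "finite (pverts H)"
  shows "card (pverts (G \<odot> H)) = card (pverts G) * (card (pverts H) + 1)"
proof -
  have "card (pverts (G \<odot> H)) = card ((\<lambda>v. (v, None :: 'b option)) ` pverts G)
      + card ((\<lambda>(v, x). (v, Some x)) ` (pverts G \<times> pverts H))"
    unfolding pverts_corona using assms by (intro card_Un_disjoint) auto
  also have "card ((\<lambda>v. (v, None :: 'b option)) ` pverts G) = card (pverts G)"
    by (intro card_image) (auto simp: inj_on_def)
  also have "card ((\<lambda>(v, x). (v, Some x)) ` (pverts G \<times> pverts H))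
      = card (pverts G) * card (pverts H)"
    by (subst card_image) (auto simp: inj_on_def card_cartesian_product)
  finally show ?thesis by simp
qed

text \<open>\<open>G\<close> is later instantiated by an iterate \<open>G \<odot>[k] H\<close>, so
  the results apply at each stage of the iteration.\<close>

locale corona_of_connected = G: pair_graph G + H: pair_graph H
  for G :: "'a pair_pre_digraph" and H :: "'b pair_pre_digraph" +
  assumes G_connected: "connected (with_proj G)"
    and H_connected: "connected (with_proj H)"
    and H_diameter: "diameter H \<le> 2"
begin

sublocale C: pair_graph "G \<odot> H"
  by (rule pair_graph_corona[OF G.pair_graph_axioms H.pair_graph_axioms])

section \<open>Distances and connectedness of the corona\<close>

lemma distance_function_base:
  assumes "s \<in> pverts G"
  shows "distance_function (G \<odot> H) (s, None)
    (\<lambda>(v, y). graph_dist G v s + (if y = None then 0 else 1))"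
  by (intro distance_function_corona_base G.distance_function_graph_dist G_connected assms)

lemma distance_function_copy:
  assumes "s \<in> pverts G" and "b \<in> pverts H"
  shows "distance_function (G \<odot> H) (s, Some b)
    (\<lambda>(v, y). case y of None \<Rightarrow> graph_dist G v s + 1
      | Some x \<Rightarrow> if v = s then graph_dist H x b else graph_dist G v s + 2)"
  using graph_dist_le_diameter[OF H.pair_finite_verts _ assms(2)] H_diameter
  by (intro distance_function_corona_copy G.distance_function_graph_dist
      H.distance_function_graph_dist G_connected H_connected assms) (meson order_trans)

lemma graph_dist_base:
  assumes "s \<in> pverts G" and "(v, y) \<in> pverts (G \<odot> H)"
  shows "graph_dist (G \<odot> H) (v, y) (s, None) = graph_dist G v s + (if y = None then 0 else 1)"
  using C.graph_dist_eqI[OF distance_function_base[OF assms(1)] assms(2)] assms(1)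
  by simp

lemma graph_dist_copy:
  assumes "s \<in> pverts G" and "b \<in> pverts H" and "(v, y) \<in> pverts (G \<odot> H)"
  shows "graph_dist (G \<odot> H) (v, y) (s, Some b) =
    (case y of None \<Rightarrow> graph_dist G v s + 1
      | Some x \<Rightarrow> if v = s then graph_dist H x b else graph_dist G v s + 2)"
  using C.graph_dist_eqI[OF distance_function_copy[OF assms(1,2)] assms(3)] assms(1,2)
  by (cases y) simp_all

lemma connected_corona: "connected (with_proj (G \<odot> H))"
proof (rule C.connected_if_distance_functions)
  show "pverts (G \<odot> H) \<noteq> {}"
    using G_connected by (simp add: connected_def strongly_connected_def pverts_corona)
  show "\<exists>f. distance_function (G \<odot> H) s f" if "s \<in> pverts (G \<odot> H)" for s
    using that
  proof (cases rule: corona_vertE)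
    case (1 v)
    then show ?thesis using distance_function_base[of v] by blast
  next
    case (2 v x)
    then show ?thesis using distance_function_copy[of v x] by blast
  qed
qed

section \<open>Resolving sets of the corona and of its copies of \<open>H\<close>\<close>

lemma resolving_set_trace:
  assumes "resolving_set (G \<odot> H) S" and v: "v \<in> pverts G"
  shows "resolving_set H {b. (v, Some b) \<in> S}"
proof -
  have sub: "S \<subseteq> pverts (G \<odot> H)"
    using assms(1) by (simp add: resolving_set_iff)
  have "\<exists>b\<in>{b. (v, Some b) \<in> S}. graph_dist H x b \<noteq> graph_dist H y b"
    if xy: "x \<in> pverts H" "y \<in> pverts H" "x \<noteq> y" for x y
  proof -
    have mem: "(v, Some x) \<in> pverts (G \<odot> H)" "(v, Some y) \<in> pverts (G \<odot> H)"
      using v xy by auto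
    then obtain s where s: "s \<in> S"
      "graph_dist (G \<odot> H) (v, Some x) s \<noteq> graph_dist (G \<odot> H) (v, Some y) s"
      using assms(1) xy unfolding resolving_set_iff by (metis option.inject prod.inject)
    have "s \<in> pverts (G \<odot> H)"
      using s(1) sub by blast
    then show ?thesis
    proof (cases rule: corona_vertE)
      case (1 w)
      then show ?thesis
        \<comment> \<open>Both distances to a base vertex \<open>w\<close> are
          \<open>graph_dist G v w + 1\<close>, contradicting the choice of \<open>s\<close>.\<close>
        using s(2) by (simp add: graph_dist_base v xy)
    next
      case (2 w b)
      \<comment> \<open>For \<open>w \<noteq> v\<close> both distances would be
        \<open>graph_dist G v w + 2\<close>.\<close>
      then have "w = v" "graph_dist H x b \<noteq> graph_dist H y b"
        using s(2) by (simp_all add: graph_dist_copy v xy split: if_splits)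
      then show ?thesis
        using s(1) 2(1) by blast
    qed
  qed
  moreover have "{b. (v, Some b) \<in> S} \<subseteq> pverts H"
    using sub by auto
  ultimately show ?thesis
    by (simp add: resolving_set_iff)
qed

text \<open>A single \<open>b\<close> of \<open>B\<close>, placed in a suitable copy, separates all
  pairs except those inside one copy; the resolving property of \<open>B\<close> serves for
  these.\<close>

lemma resolving_set_copies:
  assumes B: "resolving_set H B" "B \<noteq> {}" and "card (pverts G) \<ge> 2"
  shows "resolving_set (G \<odot> H) ((\<lambda>(v, b). (v, Some b)) ` (pverts G \<times> B))"
    (is "resolving_set _ ?S")
proof -
  have BH: "B \<subseteq> pverts H"
    using B by (simp add: resolving_set_iff)
  obtain b where b: "b \<in> B" "b \<in> pverts H"
    using B BH by auto
  let ?d = "graph_dist (G \<odot> H)"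
  have le2: "graph_dist H x y \<le> 2" if "x \<in> pverts H" "y \<in> pverts H" for x y
    using graph_dist_le_diameter[OF H.pair_finite_verts that] H_diameter by simp
  have pos: "graph_dist G v w > 0" if "v \<in> pverts G" "w \<in> pverts G" "v \<noteq> w" for v w
    using G.graph_dist_eq_0_iff[OF G_connected] that by auto
  have zero: "graph_dist G v v = 0" if "v \<in> pverts G" for v
    using G.graph_dist_eq_0_iff[OF G_connected] that by auto
  \<comment> \<open>Seen from the copy at \<open>v\<close>, the vertex \<open>(v, y)\<close> is at
    distance 1 if \<open>y\<close> is \<open>None\<close> and at most 2 otherwise, while
    \<open>(w, z)\<close> is at distance at least 2 if \<open>z\<close> is \<open>None\<close> and
    at least 3 otherwise. Only \<open>y \<noteq> None\<close> with \<open>z = None\<close> may give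
    a tie, at 2.\<close>
  have other: "?d (v, y) (v, Some b) \<noteq> ?d (w, z) (v, Some b)"
    if mem: "(v, y) \<in> pverts (G \<odot> H)" "(w, z) \<in> pverts (G \<odot> H)" and "v \<noteq> w"
      and "y = None \<or> z \<noteq> None" for v w y z
  proof -
    have v: "v \<in> pverts G" "w \<in> pverts G" "\<And>x. y = Some x \<Longrightarrow> x \<in> pverts H"
      using mem by auto
    show ?thesis
      using that v b le2[OF v(3) b(2)] pos[of w v] zero[of v]
      by (fastforce simp: graph_dist_copy split: option.splits)
  qed
  \<comment> \<open>In the copy at \<open>v\<close> itself, \<open>b\<close> fails when
    \<open>x\<close> is adjacent to it, since both distances are then 1. From the copy at another
    vertex \<open>w\<close>, the vertex \<open>(v, Some x)\<close> is always one step farther than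
    \<open>(v, None)\<close>.\<close>
  have base: "\<exists>w\<in>pverts G. ?d (v, None) (w, Some b) \<noteq> ?d (v, Some x) (w, Some b)"
    if v: "v \<in> pverts G" "x \<in> pverts H" for v x
  proof -
    have "pverts G \<noteq> {v}"
      using assms(3) by auto
    then obtain w where w: "w \<in> pverts G" "w \<noteq> v"
      using v by auto
    then show ?thesis
      using v b by (intro bexI[of _ w]) (auto simp: graph_dist_copy)
  qed
  have "\<exists>s\<in>?S. ?d (v, y) s \<noteq> ?d (w, z) s"
    if mem: "(v, y) \<in> pverts (G \<odot> H)" "(w, z) \<in> pverts (G \<odot> H)" and ne: "(v, y) \<noteq> (w, z)"
    for v w y z
  proof -
    have v: "v \<in> pverts G" "w \<in> pverts G"
      "\<And>x. y = Some x \<Longrightarrow> x \<in> pverts H" "\<And>x. z = Some x \<Longrightarrow> x \<in> pverts H"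
      using mem by auto
    have S: "(u, Some c) \<in> ?S" if "u \<in> pverts G" "c \<in> B" for u c
      using that by auto
    show ?thesis
    proof (cases "v = w")
      case False
      show ?thesis
      proof (cases "y = None \<or> z \<noteq> None")
        case True
        then show ?thesis
          using other[OF mem False] S[OF v(1) b(1)] by blast
      next
        case False': False
        \<comment> \<open>In the case of a possible tie the roles are exchanged and the pair is
          viewed from the copy at \<open>w\<close>.\<close>
        then have "?d (w, z) (w, Some b) \<noteq> ?d (v, y) (w, Some b)"
          using other[OF mem(2,1)] False False' by blast
        then show ?thesis
          by (intro bexI[OF _ S[OF v(2) b(1)]]) simp
      qed
    next
      case True
      consider x where "y = None" "z = Some x" | x where "y = Some x" "z = None"
        | x x' where "y = Some x" "z = Some x'" "x \<noteq> x'"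
        using ne True by (cases y; cases z) auto
      then show ?thesis
      proof cases
        case (1 x)
        then obtain u where "u \<in> pverts G" "?d (v, y) (u, Some b) \<noteq> ?d (w, z) (u, Some b)"
          using base[OF v(1) v(4)[OF 1(2)]] True by blast
        then show ?thesis
          using S[OF _ b(1)] by blast
      next
        case (2 x)
        then obtain u where u: "u \<in> pverts G" "?d (w, z) (u, Some b) \<noteq> ?d (v, y) (u, Some b)"
          using base[OF v(1) v(3)[OF 2(1)]] True by blast
        then show ?thesis
          using u(2) by (intro bexI[OF _ S[OF u(1) b(1)]]) simp
      next
        case 3
        then obtain c where c: "c \<in> B" "graph_dist H x c \<noteq> graph_dist H x' c"
          using B v unfolding resolving_set_iff by blast
        then have "?d (v, y) (v, Some c) \<noteq> ?d (w, z) (v, Some c)"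
          using 3 v BH mem True by (auto simp: graph_dist_copy subset_iff)
        then show ?thesis
          using S v c by blast
      qed
    qed
  qed
  then have "\<forall>p\<in>pverts (G \<odot> H). \<forall>q\<in>pverts (G \<odot> H).
      p \<noteq> q \<longrightarrow> (\<exists>s\<in>?S. ?d p s \<noteq> ?d q s)"
    by (metis surj_pair)
  moreover have "?S \<subseteq> pverts (G \<odot> H)"
    using BH by auto
  ultimately show ?thesis
    by (simp add: resolving_set_iff)
qed

lemma metric_dimension_corona:
  assumes "card (pverts G) \<ge> 2" and "card (pverts H) \<ge> 2"
  shows "metric_dimension (G \<odot> H) = card (pverts G) * metric_dimension H"
proof (rule antisym)
  obtain B where B: "resolving_set H B" "card B = metric_dimension H"
    using metric_dimension_attained[OF H.pair_graph_axioms H_connected] .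
  have "\<exists>x\<in>pverts H. \<exists>y\<in>pverts H. x \<noteq> y"
    using assms(2) card_le_Suc0_iff_eq[OF H.pair_finite_verts] by fastforce
  \<comment> \<open>An empty set cannot separate two distinct vertices.\<close>
  then have "B \<noteq> {}"
    using B(1) by (auto simp: resolving_set_iff)
  then have "metric_dimension (G \<odot> H) \<le> card ((\<lambda>(v, b). (v, Some b)) ` (pverts G \<times> B))"
    using B assms(1) by (intro metric_dimension_le C.pair_finite_verts resolving_set_copies)
  also have "\<dots> = card (pverts G) * metric_dimension H"
    using B(2) by (subst card_image) (auto simp: inj_on_def card_cartesian_product)
  finally show "metric_dimension (G \<odot> H) \<le> card (pverts G) * metric_dimension H" .
next
  obtain S where S: "resolving_set (G \<odot> H) S" "card S = metric_dimension (G \<odot> H)"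
    using metric_dimension_attained[OF C.pair_graph_axioms connected_corona] .
  define T where "T v = {b. (v, Some b) \<in> S}" for v
  have T: "resolving_set H (T v)" if "v \<in> pverts G" for v
    unfolding T_def using S(1) that by (rule resolving_set_trace)
  then have fin: "finite (T v)" if "v \<in> pverts G" for v
    using finite_subset[OF _ H.pair_finite_verts] that by (simp add: resolving_set_iff)
  have "finite S"
    using finite_subset[OF _ C.pair_finite_verts] S(1) by (simp add: resolving_set_iff)
  have "card (pverts G) * metric_dimension H = (\<Sum>v\<in>pverts G. metric_dimension H)"
    by simp
  also have "\<dots> \<le> (\<Sum>v\<in>pverts G. card (T v))"
    using T by (intro sum_mono metric_dimension_le H.pair_finite_verts)
  also have "\<dots> = card (SIGMA v:pverts G. T v)"
    using fin by (simp add: G.pair_finite_verts)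
  \<comment> \<open>The traces lie in disjoint copies, so their disjoint union embeds into
    \<open>S\<close>. Base vertices in \<open>S\<close> are not counted, so the final comparison is
    an inequality.\<close>
  also have "\<dots> = card ((\<lambda>(v, b). (v, Some b)) ` (SIGMA v:pverts G. T v))"
    by (subst card_image) (auto simp: inj_on_def)
  also have "\<dots> \<le> card S"
    using \<open>finite S\<close> by (intro card_mono) (auto simp: T_def)
  finally show "card (pverts G) * metric_dimension H \<le> metric_dimension (G \<odot> H)"
    using S(2) by simp
qed

end

section \<open>The iterated corona product\<close>

lemma inj_on_corona_relabelling: "inj_on (\<lambda>((v, ys), y). (v, y # ys)) A"
  by (rule inj_on_subset[OF inj_corona_relabelling]) simp

text \<open>Connectedness of each iterate is the hypothesis on the first factor in the next corona;
  relabelling preserves it.\<close>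

lemma connected_iterated_corona:
  assumes "pair_graph G" and "Digraph_Component.connected (with_proj G)"
    and "pair_graph H" and "Digraph_Component.connected (with_proj H)"
    and "diameter H \<le> 2"
  shows "Digraph_Component.connected (with_proj (G \<odot>[k] H))"
proof (induction k)
  case 0
  show ?case
    using assms(1,2) by (auto intro!: connected_relabel simp: inj_on_def)
next
  case (Suc k)
  interpret corona_of_connected "G \<odot>[k] H" H
    using assms Suc.IH
    by (simp add: corona_of_connected_def corona_of_connected_axioms_def pair_graph_iterated_corona)
  show ?case
    unfolding iterated_corona.simps
    by (intro connected_relabel inj_on_corona_relabelling C.pair_graph_axioms connected_corona)
qed

lemma card_pverts_iterated_corona:
  assumes "pair_graph G" and "pair_graph H"
  shows "card (pverts (G \<odot>[k] H)) = card (pverts G) * (card (pverts H) + 1) ^ k"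
proof (induction k)
  case 0
  show ?case
    by (simp add: relabel_def card_image inj_on_def)
next
  case (Suc k)
  interpret I: pair_graph "G \<odot>[k] H" by (rule pair_graph_iterated_corona[OF assms])
  interpret H: pair_graph H by (rule assms(2))
  have "card (pverts (G \<odot>[Suc k] H)) = card (pverts ((G \<odot>[k] H) \<odot> H))"
    by (simp add: relabel_def card_image[OF inj_on_corona_relabelling])
  then show ?case
    using Suc.IH card_pverts_corona[OF I.pair_finite_verts H.pair_finite_verts] by (simp add: algebra_simps)
qed

theorem theorem3:
  fixes G :: "'a pair_pre_digraph" and H :: "'b pair_pre_digraph" and n\<^sub>1 n\<^sub>2 k :: nat
  assumes "pair_graph G" and "Digraph_Component.connected (with_proj G)"
    and "card (pverts G) = n\<^sub>1" and "n\<^sub>1 \<ge> 2"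
    and "pair_graph H" and "Digraph_Component.connected (with_proj H)"
    and "card (pverts H) = n\<^sub>2" and "n\<^sub>2 \<ge> 2"
    and "diameter H \<le> 2"
    and "k \<ge> 1"
  shows "metric_dimension (G \<odot>[k] H) = n\<^sub>1 * (n\<^sub>2 + 1) ^ (k - 1) * metric_dimension H"
proof -
  \<comment> \<open>The last corona is split off, so \<open>m\<close> is the exponent
    \<open>k - 1\<close>; for \<open>m = 0\<close> the first factor is the renamed copy of
    \<open>G\<close>.\<close>
  obtain m where k: "k = Suc m"
    using assms(10) by (cases k) auto
  interpret corona_of_connected "G \<odot>[m] H" H
    using assms
    by (simp add: corona_of_connected_def corona_of_connected_axioms_def pair_graph_iterated_corona
        connected_iterated_corona)
  have card: "card (pverts (G \<odot>[m] H)) = n\<^sub>1 * (n\<^sub>2 + 1) ^ m"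
    using card_pverts_iterated_corona[OF assms(1,5)] assms(3,7) by simp
  \<comment> \<open>The iterate is at least as large as \<open>G\<close> and thus inherits the lower
    bound 2 on its order.\<close>
  moreover have "n\<^sub>1 * 1 \<le> n\<^sub>1 * (n\<^sub>2 + 1) ^ m"
    by (intro mult_le_mono2) simp
  ultimately have "card (pverts (G \<odot>[m] H)) \<ge> 2"
    using assms(4) by linarith
  then have "metric_dimension ((G \<odot>[m] H) \<odot> H) = n\<^sub>1 * (n\<^sub>2 + 1) ^ m * metric_dimension H"
    using metric_dimension_corona assms(7,8) card by simp
  then show ?thesis
    \<comment> \<open>The iterate \<open>G \<odot>[Suc m] H\<close> is this corona with its vertices
      renamed injectively.\<close>
    using metric_dimension_relabel[OF inj_on_corona_relabelling C.pair_graph_axioms connected_corona] k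
    by simp
qed

end
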